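(* Let $\{D_i : i\in I\}$ be an uncountable family of nontrivial discrete Abelian groups and let $D=\prod_{i\in I}D_i$. Then the $\Sigma$-product $\Sigma D$, regarded as a topological subgroup of $PD$, is not reflexive.
   Context: $\mathbb T=\{z\in\mathbb C:|z|=1\}$ is the circle group. For a topological Abelian group $G$, $G^\wedge$ is the group of continuous characters (continuous homomorphisms $G\to\mathbb T$) with the topology of uniform convergence on compact subsets of $G$. $G$ is reflexive if the evaluation homomorphism $\alpha_G:G\to G^{\wedge\wedge}$, $\alpha_G(x)(\chi)=\chi(x)$, is a topological isomorphism of $G$ onto $G^{\wedge\wedge}=(G^\wedge)^\wedge$. For a topological group $H$, $PH$ ($P$-modification) is the same group with the finer group topology whose base consists of all $G_\delta$-sets of $H$. $D=\prod_{i\in I}D_i$ carries the Tychonoff product topology, and $PD$ is the $P$-modification of this product. For $x\in D$, $\operatorname{supp}(x)=\{i\in I: x(i)\ne 0_i\}$, where $0_i$ is the neutral element of $D_i$; $\Sigma D=\{x\in D: |\operatorname{supp}(x)|\le\omega\}$, with the topology inherited from $PD$. *)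

theory Defs
  imports "HOL-Analysis.Analysis" "HOL-Algebra.Product_Groups"
begin

(* An Abelian topological group is given by an HOL-Algebra group G together with an
   abstract topology T such that topspace T = carrier G. *)

definition circle_group :: "complex monoid"
  where "circle_group = \<lparr>carrier = sphere 0 1, monoid.mult = (*), one = 1\<rparr>"

definition circle_topology :: "complex topology"
  where "circle_topology = top_of_set (sphere 0 1)"

(* Characters are made extensional, so that HOL equality of characters is
   equality as functions on the carrier of G. *)
definition characters :: "('a, 'm) monoid_scheme \<Rightarrow> 'a topology \<Rightarrow> ('a \<Rightarrow> complex) set"
  where "characters G T =
    {\<phi> \<in> extensional (carrier G). \<phi> \<in> hom G circle_group \<and> continuous_map T circle_topology \<phi>}"

definition dual_group :: "('a, 'm) monoid_scheme \<Rightarrow> 'a topology \<Rightarrow> ('a \<Rightarrow> complex) monoid"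
  where "dual_group G T =
    \<lparr>carrier = characters G T,
     monoid.mult = (\<lambda>\<phi> \<psi>. \<lambda>x\<in>carrier G. \<phi> x * \<psi> x),
     one = (\<lambda>x\<in>carrier G. 1)\<rparr>"

definition uniform_nbhd ::
    "('a, 'm) monoid_scheme \<Rightarrow> 'a topology \<Rightarrow> 'a set \<Rightarrow> real \<Rightarrow> ('a \<Rightarrow> complex) \<Rightarrow> ('a \<Rightarrow> complex) set"
  where "uniform_nbhd G T K e \<phi> = {\<psi> \<in> characters G T. \<forall>x\<in>K. dist (\<psi> x) (\<phi> x) < e}"

(* The topology of uniform convergence on compact subsets; see openin_dual_topology. *)
definition dual_topology :: "('a, 'm) monoid_scheme \<Rightarrow> 'a topology \<Rightarrow> ('a \<Rightarrow> complex) topology"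
  where "dual_topology G T = topology (\<lambda>U. U \<subseteq> characters G T \<and>
    (\<forall>\<phi>\<in>U. \<exists>K e. compactin T K \<and> e > 0 \<and> uniform_nbhd G T K e \<phi> \<subseteq> U))"

definition evaluation ::
    "('a, 'm) monoid_scheme \<Rightarrow> 'a topology \<Rightarrow> 'a \<Rightarrow> (('a \<Rightarrow> complex) \<Rightarrow> complex)"
  where "evaluation G T = (\<lambda>x\<in>carrier G. \<lambda>\<phi>\<in>characters G T. \<phi> x)"

definition reflexive_group :: "('a, 'm) monoid_scheme \<Rightarrow> 'a topology \<Rightarrow> bool"
  where "reflexive_group G T \<longleftrightarrow>
    evaluation G T \<in> iso G (dual_group (dual_group G T) (dual_topology G T)) \<and>
    homeomorphic_map T (dual_topology (dual_group G T) (dual_topology G T)) (evaluation G T)"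

lemma openin_dual_topology:
  "openin (dual_topology G T) U \<longleftrightarrow> U \<subseteq> characters G T \<and>
    (\<forall>\<phi>\<in>U. \<exists>K e. compactin T K \<and> e > 0 \<and> uniform_nbhd G T K e \<phi> \<subseteq> U)"
proof -
  let ?P = "\<lambda>U. U \<subseteq> characters G T \<and>
    (\<forall>\<phi>\<in>U. \<exists>K e. compactin T K \<and> e > 0 \<and> uniform_nbhd G T K e \<phi> \<subseteq> U)"
  have "istopology ?P"
    unfolding istopology_def
  proof (intro conjI allI impI)
    fix S U assume S: "?P S" and U: "?P U"
    show "S \<inter> U \<subseteq> characters G T" using S by blast
    show "\<forall>\<phi>\<in>S \<inter> U. \<exists>K e. compactin T K \<and> e > 0 \<and> uniform_nbhd G T K e \<phi> \<subseteq> S \<inter> U"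
    proof
      fix \<phi> assume "\<phi> \<in> S \<inter> U"
      with S U obtain K e K' e' where
        K: "compactin T K" "e > 0" "uniform_nbhd G T K e \<phi> \<subseteq> S" and
        K': "compactin T K'" "e' > 0" "uniform_nbhd G T K' e' \<phi> \<subseteq> U"
        by blast
      have "uniform_nbhd G T (K \<union> K') (min e e') \<phi> \<subseteq> S \<inter> U"
        using K(3) K'(3) unfolding uniform_nbhd_def by auto
      moreover have "compactin T (K \<union> K')" "min e e' > 0"
        using K K' by (auto intro: compactin_Un)
      ultimately show "\<exists>K e. compactin T K \<and> e > 0 \<and> uniform_nbhd G T K e \<phi> \<subseteq> S \<inter> U"
        by blast
    qed
  next
    fix \<K> assume \<K>: "\<forall>U\<in>\<K>. ?P U"
    show "\<Union>\<K> \<subseteq> characters G T" using \<K> by blast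
    show "\<forall>\<phi>\<in>\<Union>\<K>. \<exists>K e. compactin T K \<and> e > 0 \<and> uniform_nbhd G T K e \<phi> \<subseteq> \<Union>\<K>"
    proof
      fix \<phi> assume "\<phi> \<in> \<Union>\<K>"
      then obtain U where "U \<in> \<K>" "\<phi> \<in> U" by blast
      with \<K> show "\<exists>K e. compactin T K \<and> e > 0 \<and> uniform_nbhd G T K e \<phi> \<subseteq> \<Union>\<K>"
        by (meson Union_upper subset_trans)
    qed
  qed
  then show ?thesis
    by (simp add: dual_topology_def)
qed

lemma topspace_dual_topology: "topspace (dual_topology G T) = carrier (dual_group G T)"
proof -
  have "openin (dual_topology G T) (characters G T)"
    unfolding openin_dual_topology
  proof (intro conjI ballI exI)
    show "compactin T {}" by simp
    show "(1::real) > 0" by simp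
  qed (simp_all add: uniform_nbhd_def)
  moreover have "topspace (dual_topology G T) \<subseteq> characters G T"
    using openin_topspace[of "dual_topology G T"] unfolding openin_dual_topology by (rule conjunct1)
  ultimately show ?thesis
    by (simp add: dual_group_def openin_subset subset_antisym)
qed

definition P_modification :: "'a topology \<Rightarrow> 'a topology"
  where "P_modification X = topology (arbitrary union_of gdelta_in X)"

lemma openin_P_modification:
  "openin (P_modification X) = arbitrary union_of gdelta_in X"
  unfolding P_modification_def
  by (simp add: gdelta_in_Int istopology_base)

lemma topspace_P_modification: "topspace (P_modification X) = topspace X"
proof (rule antisym)
  show "topspace (P_modification X) \<subseteq> topspace X"
    using openin_topspace[of "P_modification X"]
    unfolding openin_P_modification unfolding union_of_def
    by (blast dest: gdelta_in_subset)
  show "topspace X \<subseteq> topspace (P_modification X)"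
    by (rule openin_subset) (simp add: openin_P_modification arbitrary_union_of_inc)
qed

definition supp :: "'i set \<Rightarrow> ('i \<Rightarrow> ('a, 'm) monoid_scheme) \<Rightarrow> ('i \<Rightarrow> 'a) \<Rightarrow> 'i set"
  where "supp I D x = {i \<in> I. x i \<noteq> \<one>\<^bsub>D i\<^esub>}"

definition sigma_carrier :: "'i set \<Rightarrow> ('i \<Rightarrow> ('a, 'm) monoid_scheme) \<Rightarrow> ('i \<Rightarrow> 'a) set"
  where "sigma_carrier I D = {x \<in> carrier (product_group I D). countable (supp I D x)}"

definition sigma_product :: "'i set \<Rightarrow> ('i \<Rightarrow> ('a, 'm) monoid_scheme) \<Rightarrow> ('i \<Rightarrow> 'a) monoid"
  where "sigma_product I D = (product_group I D)\<lparr>carrier := sigma_carrier I D\<rparr>"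

definition discrete_product_topology ::
    "'i set \<Rightarrow> ('i \<Rightarrow> ('a, 'm) monoid_scheme) \<Rightarrow> ('i \<Rightarrow> 'a) topology"
  where "discrete_product_topology I D = product_topology (\<lambda>i. discrete_topology (carrier (D i))) I"

definition sigma_topology :: "'i set \<Rightarrow> ('i \<Rightarrow> ('a, 'm) monoid_scheme) \<Rightarrow> ('i \<Rightarrow> 'a) topology"
  where "sigma_topology I D =
    subtopology (P_modification (discrete_product_topology I D)) (sigma_carrier I D)"

lemma subgroup_sigma_carrier:
  assumes "\<And>i. i \<in> I \<Longrightarrow> group (D i)"
  shows "subgroup (sigma_carrier I D) (product_group I D)"
proof -
  interpret P: group "product_group I D" using assms by simp
  show ?thesis
  proof (rule P.subgroupI)
    show "sigma_carrier I D \<subseteq> carrier (product_group I D)"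
      by (auto simp: sigma_carrier_def)
    have "supp I D \<one>\<^bsub>product_group I D\<^esub> = {}" by (auto simp: supp_def)
    then have "\<one>\<^bsub>product_group I D\<^esub> \<in> sigma_carrier I D"
      unfolding sigma_carrier_def using P.one_closed by auto
    then show "sigma_carrier I D \<noteq> {}" by blast
  next
    fix x assume x: "x \<in> sigma_carrier I D"
    then have xP: "x \<in> carrier (product_group I D)" by (simp add: sigma_carrier_def)
    have "supp I D (inv\<^bsub>product_group I D\<^esub> x) \<subseteq> supp I D x"
      using xP assms by (auto simp: supp_def group.is_monoid monoid.inv_one)
    with x P.inv_closed[OF xP] show "inv\<^bsub>product_group I D\<^esub> x \<in> sigma_carrier I D"
      unfolding sigma_carrier_def by (auto intro: countable_subset)
  next
    fix x y assume x: "x \<in> sigma_carrier I D" and y: "y \<in> sigma_carrier I D"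
    then have xP: "x \<in> carrier (product_group I D)" and yP: "y \<in> carrier (product_group I D)"
      by (simp_all add: sigma_carrier_def)
    have "supp I D (x \<otimes>\<^bsub>product_group I D\<^esub> y) \<subseteq> supp I D x \<union> supp I D y"
      using assms by (auto simp: supp_def group.is_monoid)
    moreover have "countable (supp I D x \<union> supp I D y)"
      using x y by (simp add: sigma_carrier_def)
    ultimately show "x \<otimes>\<^bsub>product_group I D\<^esub> y \<in> sigma_carrier I D"
      using P.m_closed[OF xP yP] unfolding sigma_carrier_def
      by (auto intro: countable_subset)
  qed
qed

lemma topspace_sigma_topology:
  "topspace (sigma_topology I D) = carrier (sigma_product I D)"
  by (auto simp: sigma_topology_def topspace_P_modification discrete_product_topology_def
      sigma_product_def sigma_carrier_def)

end

theory Submission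
  imports Defs
begin

text \<open>
  Choose a character \<open>c\<^sub>i\<close> of each \<open>D\<^sub>i\<close> moving some point at distance at least \<open>1/2\<close> from \<open>1\<close>,
  and let \<open>p\<^sub>i\<close> be its composition with the \<open>i\<close>-th projection of \<open>\<Sigma>D\<close>. Compact subsets of \<open>\<Sigma>D\<close>
  are finite, so the dual carries the topology of pointwise convergence. The pointwise closure \<open>K\<close> of
  \<open>{p\<^sub>i}\<close> is compact by Tychonoff, and it consists of continuous characters: an element of \<open>K\<close> either lies
  in the closure of countably many \<open>p\<^sub>i\<close>, and then depends on countably many coordinates only, or it
  is trivial, because \<open>p\<^sub>i(x) = 1\<close> for \<open>i\<close> outside the countable support of \<open>x\<close>. But every
  neighbourhood of the identity of \<open>\<Sigma>D\<close> leaves some coordinate \<open>i\<close> free, where \<open>p\<^sub>i \<in> K\<close> is not small.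
  So the evaluation map is not continuous.
\<close>

section \<open>Arithmetic of the circle group and extension of characters from subgroups of an
  Abelian group\<close>

lemma comm_group_circle_group: "comm_group circle_group"
proof (rule comm_groupI)
  fix x assume "x \<in> carrier circle_group"
  then have "inverse x \<in> carrier circle_group" "inverse x \<otimes>\<^bsub>circle_group\<^esub> x = \<one>\<^bsub>circle_group\<^esub>"
    by (auto simp: circle_group_def norm_inverse intro!: left_inverse)
  then show "\<exists>y\<in>carrier circle_group. y \<otimes>\<^bsub>circle_group\<^esub> x = \<one>\<^bsub>circle_group\<^esub>" by blast
qed (auto simp: circle_group_def norm_mult)

lemma circle_group_simps [simp]:
  "carrier circle_group = sphere 0 1" "x \<otimes>\<^bsub>circle_group\<^esub> y = x * y" "\<one>\<^bsub>circle_group\<^esub> = 1"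
  by (simp_all add: circle_group_def)

lemma inv_circle_group: "z \<in> sphere 0 1 \<Longrightarrow> inv\<^bsub>circle_group\<^esub> z = inverse z"
proof -
  assume z: "z \<in> sphere 0 1"
  interpret comm_group circle_group by (rule comm_group_circle_group)
  show ?thesis
    by (rule inv_equality) (use z in \<open>auto simp: norm_inverse intro!: left_inverse\<close>)
qed

lemma nat_pow_circle_group: "z [^]\<^bsub>circle_group\<^esub> (n::nat) = z ^ n"
proof -
  interpret comm_group circle_group by (rule comm_group_circle_group)
  show ?thesis by (induction n) auto
qed

lemma int_pow_circle_group: "z \<in> sphere 0 1 \<Longrightarrow> z [^]\<^bsub>circle_group\<^esub> (n::int) = z powi n"
proof -
  assume z: "z \<in> sphere 0 1"
  then have "z ^ k \<in> sphere 0 1" for k by (auto simp: norm_power)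
  then show ?thesis
    by (auto simp: int_pow_def2 nat_pow_circle_group inv_circle_group power_int_def power_inverse)
qed

lemma int_pow_DirProd:
  assumes "group G" "group H" "x \<in> carrier G" "y \<in> carrier H"
  shows "(x, y) [^]\<^bsub>G \<times>\<times> H\<^esub> (n::int) = (x [^]\<^bsub>G\<^esub> n, y [^]\<^bsub>H\<^esub> n)"
proof -
  have nat: "(x, y) [^]\<^bsub>G \<times>\<times> H\<^esub> (k::nat) = (x [^]\<^bsub>G\<^esub> k, y [^]\<^bsub>H\<^esub> k)" for k
    by (induction k) auto
  interpret G: group G by fact
  interpret H: group H by fact
  show ?thesis
    unfolding int_pow_def2 nat using assms by simp
qed

context comm_group
begin

text \<open>A character of a subgroup, encoded by its graph.\<close>
definition partial_character :: "('a \<times> complex) set \<Rightarrow> bool"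
  where "partial_character F \<longleftrightarrow>
    subgroup F (G \<times>\<times> circle_group) \<and> (\<forall>w. (\<one>, w) \<in> F \<longrightarrow> w = 1)"

lemma partial_character_closed:
  assumes "partial_character F"
  shows "(\<one>, 1) \<in> F"
    "(x, u) \<in> F \<Longrightarrow> x \<in> carrier G \<and> u \<in> sphere 0 1"
    "(x, u) \<in> F \<Longrightarrow> (y, v) \<in> F \<Longrightarrow> (x \<otimes> y, u * v) \<in> F"
    "(x, u) \<in> F \<Longrightarrow> (x [^] (n::int), u powi n) \<in> F"
    "(x, u) \<in> F \<Longrightarrow> (x, v) \<in> F \<Longrightarrow> u = v"
proof -
  interpret C: comm_group circle_group by (rule comm_group_circle_group)
  interpret P: group "G \<times>\<times> circle_group"
    by (rule DirProd_group) unfold_locales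
  have F: "subgroup F (G \<times>\<times> circle_group)" and one: "\<And>w. (\<one>, w) \<in> F \<Longrightarrow> w = 1"
    using assms by (auto simp: partial_character_def)
  show "(\<one>, 1) \<in> F" using subgroup.one_closed[OF F] by simp
  have car: "x \<in> carrier G \<and> u \<in> sphere 0 1" if "(x, u) \<in> F" for x u
    using subgroup.subset[OF F] that by auto
  show "(x, u) \<in> F \<Longrightarrow> x \<in> carrier G \<and> u \<in> sphere 0 1" by (rule car)
  have mul: "(x \<otimes> y, u * v) \<in> F" if "(x, u) \<in> F" "(y, v) \<in> F" for x y u v
    using subgroup.m_closed[OF F that] by simp
  show "(x, u) \<in> F \<Longrightarrow> (y, v) \<in> F \<Longrightarrow> (x \<otimes> y, u * v) \<in> F" by (rule mul)
  have pow: "(x [^] n, u powi n) \<in> F" if "(x, u) \<in> F" for x u and n :: int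
  proof -
    have "(x, u) [^]\<^bsub>G \<times>\<times> circle_group\<^esub> n \<in> F"
      using P.subgroup_int_pow_closed[OF F that] .
    then show ?thesis
      using car[OF that] by (simp add: int_pow_DirProd is_group C.is_group int_pow_circle_group)
  qed
  show "(x, u) \<in> F \<Longrightarrow> (x [^] (n::int), u powi n) \<in> F" by (rule pow)
  show "u = v" if "(x, u) \<in> F" "(x, v) \<in> F"
  proof -
    \<comment> \<open>The quotient of the two pairs lies above \<open>\<one>\<close>, so the trivial
      fibre there forces \<open>u = v\<close>; this is what makes \<open>F\<close> the graph of a
      function.\<close>
    have "(x [^] (-1::int) \<otimes> x, u powi (-1) * v) \<in> F"
      using mul pow that by blast
    moreover have "x [^] (-1::int) \<otimes> x = \<one>"
      using car[OF that(1)] by (simp add: int_pow_neg)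
    ultimately have "inverse u * v = 1"
      using one by (simp add: power_int_minus)
    moreover have "u \<noteq> 0" using car[OF that(1)] by auto
    ultimately show ?thesis by (simp add: field_simps)
  qed
qed

text \<open>The new graph is the subgroup generated by \<open>F\<close> and \<open>(g, z)\<close>.
  The assumption \<open>compat\<close> says that \<open>z\<close> agrees with \<open>F\<close> on
  all powers of \<open>g\<close> already in the domain, which keeps the fibre above
  \<open>\<one>\<close> trivial.\<close>

lemma partial_character_adjoin:
  assumes F: "partial_character F" and g: "g \<in> carrier G" and z: "z \<in> sphere 0 1"
    and compat: "\<And>(n::int) w. (g [^] n, w) \<in> F \<Longrightarrow> w = z powi n"
  obtains F' where "partial_character F'" "F \<subseteq> F'" "(g, z) \<in> F'"
proof
  let ?P = "G \<times>\<times> circle_group"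
  interpret C: comm_group circle_group by (rule comm_group_circle_group)
  interpret P: group ?P
    by (rule DirProd_group) unfold_locales
  note F' = partial_character_closed[OF F]
  define E where "E = {(x \<otimes> g [^] n, u * z powi n) | x u (n::int). (x, u) \<in> F}"
  have z0: "z \<noteq> 0" using z by auto
  have zn: "norm (z powi n) = 1" for n using z by (simp add: norm_power_int)
  show "F \<subseteq> E"
  proof (rule subrelI)
    fix x u assume "(x, u) \<in> F"
    then show "(x, u) \<in> E"
      using F'(2) g unfolding E_def by (auto intro!: exI[of _ x] exI[of _ u] exI[of _ "0::int"])
  qed
  show "(g, z) \<in> E"
    unfolding E_def using F'(1) g by (auto intro!: exI[of _ \<one>] exI[of _ 1] exI[of _ "1::int"])
  show "partial_character E"
    unfolding partial_character_def
  proof (intro conjI allI impI)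
    show "subgroup E ?P"
    proof (rule P.subgroupI)
      show "E \<subseteq> carrier ?P" unfolding E_def using F'(2) g zn by (auto simp: norm_mult)
      show "E \<noteq> {}" unfolding E_def using F'(1) by blast
    next
      fix a assume "a \<in> E"
      then obtain x u n where a: "a = (x \<otimes> g [^] (n::int), u * z powi n)" and xu: "(x, u) \<in> F"
        unfolding E_def by blast
      have "(x [^] (-1::int), u powi (-1)) \<in> F" using F'(4)[OF xu] .
      moreover have "inv\<^bsub>?P\<^esub> a = (x [^] (-1::int) \<otimes> g [^] (-n), u powi (-1) * z powi (-n))"
        using F'(2)[OF xu] g zn unfolding a
        by (simp add: is_group C.is_group inv_circle_group norm_mult inv_mult int_pow_neg power_int_minus)
      ultimately show "inv\<^bsub>?P\<^esub> a \<in> E" unfolding E_def by blast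
    next
      fix a b assume "a \<in> E" "b \<in> E"
      then obtain x u n y v m where a: "a = (x \<otimes> g [^] (n::int), u * z powi n)" "(x, u) \<in> F"
        and b: "b = (y \<otimes> g [^] (m::int), v * z powi m)" "(y, v) \<in> F"
        unfolding E_def by blast
      have "a \<otimes>\<^bsub>?P\<^esub> b = (x \<otimes> y \<otimes> g [^] (n + m), u * v * z powi (n + m))"
        using F'(2)[OF a(2)] F'(2)[OF b(2)] g z0 unfolding a b
        by (simp add: int_pow_mult power_int_add m_ac)
      then show "a \<otimes>\<^bsub>?P\<^esub> b \<in> E"
        unfolding E_def using F'(3)[OF a(2) b(2)] by blast
    qed
  next
    fix w assume "(\<one>, w) \<in> E"
    then obtain x u n where x: "\<one> = x \<otimes> g [^] (n::int)" "w = u * z powi n" "(x, u) \<in> F"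
      unfolding E_def by blast
    have xc: "x \<in> carrier G" and u: "u \<in> sphere 0 1" using F'(2)[OF x(3)] by auto
    \<comment> \<open>An element above \<open>\<one>\<close> comes from a pair \<open>(x, u)\<close>
      whose inverse lies above \<open>g [^] n\<close>, where \<open>compat\<close> determines the
      value.\<close>
    have "x = inv (g [^] n)"
      using x(1) xc g inv_equality[of x "g [^] n"] by (simp)
    then have "x [^] (-1::int) = g [^] n" using g xc by (simp add: int_pow_neg)
    with F'(4)[OF x(3), of "-1"] have "(g [^] n, inverse u) \<in> F"
      by (simp add: power_int_minus)
    then have "inverse u = z powi n" by (rule compat)
    moreover have "u \<noteq> 0" using u by auto
    ultimately show "w = 1" using x(2) by (metis right_inverse)
  qed
qed

text \<open>Outside the domain the value at \<open>g\<close> is either free or constrained only to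
  be an \<open>m\<close>-th root of a given number with \<open>m \<ge> 2\<close>; both cases leave a
  choice different from 1.\<close>

lemma partial_character_extend:
  assumes F: "partial_character F" and g: "g \<in> carrier G" and new: "g \<notin> Domain F"
  obtains F' z where "partial_character F'" "F \<subseteq> F'" "(g, z) \<in> F'" "z \<noteq> 1"
proof -
  note F' = partial_character_closed[OF F]
  have "\<exists>z\<in>sphere 0 1. z \<noteq> 1 \<and> (\<forall>(n::int) w. (g [^] n, w) \<in> F \<longrightarrow> w = z powi n)"
  proof (cases "\<exists>m::nat. m > 0 \<and> g [^] m \<in> Domain F")
    case False
    have "n = 0" if n: "(g [^] (n::int), w) \<in> F" for n w
    proof (rule ccontr)
      assume "n \<noteq> 0"
      \<comment> \<open>Multiplying the exponent by its sign turns it into the natural number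
        \<open>\<bar>n\<bar>\<close>, to which the case assumption applies.\<close>
      have "(g [^] (n * sgn n), w powi sgn n) \<in> F"
        using F'(4)[OF n, of "sgn n"] g by (simp add: int_pow_pow)
      moreover have "g [^] (n * sgn n) = g [^] nat \<bar>n\<bar>"
        by (metis abs_sgn int_pow_int abs_ge_zero nat_0_le)
      ultimately show False using False \<open>n \<noteq> 0\<close> by (metis DomainI zero_less_abs_iff zero_less_nat_eq)
    qed
    \<comment> \<open>Only \<open>n = 0\<close> with \<open>w = 1\<close> can occur, so every point
      of the circle is compatible; -1 serves as one that differs from 1.\<close>
    then have "w = (-1) powi n" if "(g [^] (n::int), w) \<in> F" for n w
      using that F'(1) F'(5)[of \<one> 1 w] by fastforce
    then show ?thesis by (intro bexI[of _ "-1"]) auto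
  next
    case True
    define m where "m = (LEAST m::nat. m > 0 \<and> g [^] m \<in> Domain F)"
    have m: "m > 0" "g [^] m \<in> Domain F" and least: "\<And>k. k > 0 \<Longrightarrow> g [^] k \<in> Domain F \<Longrightarrow> m \<le> k"
      using LeastI_ex[OF True] unfolding m_def[symmetric] by (auto simp: m_def intro: Least_le)
    obtain w where w: "(g [^] m, w) \<in> F" using m by blast
    have "m \<noteq> 1" using m new g by auto
    with m have m2: "m \<ge> 2" by simp
    have w0: "norm w = 1" using F'(2)[OF w] by simp
    then have "w \<noteq> 0" by auto
    \<comment> \<open>The nonzero \<open>w\<close> has \<open>m \<ge> 2\<close> distinct
      \<open>m\<close>-th roots, so one of them is not 1.\<close>
    then have "card {z. z ^ m = w} = m" using m card_nth_roots by blast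
    then have "\<not> {z. z ^ m = w} \<subseteq> {1}"
      using m2 card_mono[of "{1::complex}" "{z. z ^ m = w}"] by auto
    then obtain z where z: "z ^ m = w" "z \<noteq> 1" by blast
    have "norm z ^ m = 1" using z w0 by (metis norm_power)
    then have nz: "norm z = 1" using m power_eq_imp_eq_base[of "norm z" m 1] by simp
    have "v = z powi n" if n: "(g [^] (n::int), v) \<in> F" for n v
    proof -
      \<comment> \<open>The remainder power \<open>g [^] r\<close> is again in the domain, so
        minimality of \<open>m\<close> gives \<open>r = 0\<close>: only multiples of
        \<open>m\<close> have to be checked.\<close>
      define q r where "q = n div int m" and "r = nat (n mod int m)"
      have nqr: "n = int m * q + int r" using m by (simp add: q_def r_def)
      have wq: "(g [^] (int m * q), w powi q) \<in> F"
        using F'(4)[OF w, of q] int_pow_pow[OF g, of "int m" q] by (simp add: int_pow_int)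
      have "(g [^] n \<otimes> (g [^] (int m * q)) [^] (-1::int), v * (w powi q) powi (-1)) \<in> F"
        using F'(3)[OF n F'(4)[OF wq]] .
      moreover have "g [^] n \<otimes> (g [^] (int m * q)) [^] (-1::int) = g [^] r"
      proof -
        have "g [^] n \<otimes> (g [^] (int m * q)) [^] (-1::int) = g [^] (n + int m * q * - 1)"
          using g by (simp only: int_pow_pow int_pow_mult)
        also have "n + int m * q * - 1 = int r" by (simp add: nqr)
        finally show ?thesis by (simp add: int_pow_int)
      qed
      ultimately have "g [^] r \<in> Domain F" by auto
      moreover have "r < m" using m by (simp add: r_def nat_less_iff)
      ultimately have "r = 0" using least[of r] by fastforce
      then have "g [^] n = g [^] (int m * q)" using nqr by simp
      then have "v = w powi q" using F'(5)[OF n] wq by simp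
      also have "\<dots> = z powi n"
        using z \<open>r = 0\<close> unfolding nqr by (simp add: power_int_mult)
      finally show ?thesis .
    qed
    then show ?thesis using z nz by (intro bexI[of _ z]) auto
  qed
  then obtain z where "z \<in> sphere 0 1" "z \<noteq> 1"
    "\<And>(n::int) w. (g [^] n, w) \<in> F \<Longrightarrow> w = z powi n" by blast
  then show ?thesis using partial_character_adjoin[OF F g, of z] that[of _ z] by blast
qed

text \<open>The trivial graph is first extended to \<open>a\<close> with a value other than 1, then
  to a maximal graph by Zorn's lemma. A maximal graph has full domain, since otherwise it could be
  extended once more.\<close>

lemma nontrivial_character:
  assumes a: "a \<in> carrier G" "a \<noteq> \<one>"
  obtains \<psi> where "\<psi> \<in> hom G circle_group" "\<psi> a \<noteq> 1"
proof -
  let ?P = "G \<times>\<times> circle_group"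
  interpret C: comm_group circle_group by (rule comm_group_circle_group)
  interpret P: group ?P
    by (rule DirProd_group) unfold_locales
  have "partial_character {(\<one>, 1)}"
    unfolding partial_character_def using P.triv_subgroup by simp
  then obtain F0 z where F0: "partial_character F0" "(a, z) \<in> F0" "z \<noteq> 1"
    using partial_character_extend[of "{(\<one>, 1)}" a] a by blast
  define A where "A = {F. partial_character F \<and> F0 \<subseteq> F}"
  have "\<exists>M\<in>A. \<forall>X\<in>A. M \<subseteq> X \<longrightarrow> X = M"
  proof (rule subset_Zorn_nonempty)
    show "A \<noteq> {}" using F0 by (auto simp: A_def)
    fix \<C> assume ne: "\<C> \<noteq> {}" and ch: "subset.chain A \<C>"
    have sub: "\<And>F. F \<in> \<C> \<Longrightarrow> partial_character F \<and> F0 \<subseteq> F"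
      using ch by (auto simp: subset.chain_def A_def)
    have F: "subgroup F ?P" if "F \<in> \<C>" for F
      using sub[OF that] by (simp add: partial_character_def)
    have "subgroup (\<Union>\<C>) ?P"
    proof (rule P.subgroupI)
      show "\<Union>\<C> \<subseteq> carrier ?P" by (intro Union_least subgroup.subset F)
      obtain X where "X \<in> \<C>" using ne by blast
      then show "\<Union>\<C> \<noteq> {}" using subgroup.one_closed[OF F, of X] by fast
      show "inv\<^bsub>?P\<^esub> x \<in> \<Union>\<C>" if "x \<in> \<Union>\<C>" for x
        using that subgroup.m_inv_closed[OF F] by (metis UnionE UnionI)
      show "x \<otimes>\<^bsub>?P\<^esub> y \<in> \<Union>\<C>" if xy: "x \<in> \<Union>\<C>" "y \<in> \<Union>\<C>" for x y
      proof -
        obtain X Y where XY: "x \<in> X" "X \<in> \<C>" "y \<in> Y" "Y \<in> \<C>" using xy by blast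
        then have "X \<subseteq> Y \<or> Y \<subseteq> X" using ch by (auto simp: subset_chain_def)
        then show ?thesis
        proof
          assume "X \<subseteq> Y"
          then have "x \<otimes>\<^bsub>?P\<^esub> y \<in> Y" using XY subgroup.m_closed[OF F] by blast
          then show ?thesis using XY by blast
        next
          assume "Y \<subseteq> X"
          then have "x \<otimes>\<^bsub>?P\<^esub> y \<in> X" using XY subgroup.m_closed[OF F] by blast
          then show ?thesis using XY by blast
        qed
      qed
    qed
    then show "\<Union>\<C> \<in> A" using sub ne by (auto simp: A_def partial_character_def)
  qed
  then obtain M where "M \<in> A" and M_max: "\<forall>X\<in>A. M \<subseteq> X \<longrightarrow> X = M" by blast
  then have M: "partial_character M" "F0 \<subseteq> M" by (simp_all add: A_def)
  have max: "X = M" if "partial_character X" "M \<subseteq> X" for X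
    using M_max that M(2) by (simp add: A_def)
  note M' = partial_character_closed[OF M(1)]
  have "\<exists>w. (g, w) \<in> M" if g: "g \<in> carrier G" for g
  proof (rule ccontr)
    assume "\<nexists>w. (g, w) \<in> M"
    then have "g \<notin> Domain M" by blast
    then obtain F z where "partial_character F" "M \<subseteq> F" "(g, z) \<in> F"
      using partial_character_extend[OF M(1) g] by blast
    with max[of F] \<open>\<nexists>w. (g, w) \<in> M\<close> show False by blast
  qed
  then obtain \<psi> where \<psi>: "\<And>g. g \<in> carrier G \<Longrightarrow> (g, \<psi> g) \<in> M" by metis
  show ?thesis
  proof
    show "\<psi> \<in> hom G circle_group"
    proof (rule homI)
      show "\<psi> x \<in> carrier circle_group" if "x \<in> carrier G" for x
        using \<psi>[OF that] M'(2) by auto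
      show "\<psi> (x \<otimes> y) = \<psi> x \<otimes>\<^bsub>circle_group\<^esub> \<psi> y" if "x \<in> carrier G" "y \<in> carrier G" for x y
        using M'(5)[OF \<psi> M'(3)[OF \<psi> \<psi>]] that by simp
    qed
    have "(a, z) \<in> M" using F0 M by blast
    then show "\<psi> a \<noteq> 1" using M'(5)[OF \<psi>[OF a(1)]] F0 by blast
  qed
qed

end

section \<open>Characters at a uniform distance from the trivial one\<close>

text \<open>If a power \<open>w\<close> of \<open>z\<close> is within 1/2 of 1, then
  \<open>w + 1\<close> has norm at least 3/2, and \<open>w^2 - 1 = (w + 1) * (w - 1)\<close> shows
  that squaring increases the distance from 1 by that factor. Repeated squaring would then exceed
  every bound.\<close>

lemma circle_no_small_subgroups:
  fixes z :: complex
  assumes "norm z = 1" "z \<noteq> 1"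
  shows "\<exists>k. dist (z ^ k) 1 \<ge> 1/2"
proof (rule ccontr)
  assume "\<not> ?thesis"
  then have small: "norm (z ^ k - 1) < 1/2" for k by (auto simp: dist_norm not_le)
  have grow: "norm (z ^ (2 ^ n) - 1) \<ge> (3/2) ^ n * norm (z - 1)" for n
  proof (induction n)
    case (Suc n)
    let ?w = "z ^ (2 ^ n)"
    have "norm ((2::complex) - (1 - ?w)) \<ge> norm (2::complex) - norm (1 - ?w)"
      by (rule norm_triangle_ineq2)
    then have "norm (?w + 1) \<ge> 3/2"
      using small[of "2 ^ n"] by (simp add: norm_minus_commute add.commute)
    then have "(3/2) * norm (?w - 1) \<le> norm (?w + 1) * norm (?w - 1)"
      by (intro mult_right_mono) auto
    also have "(?w + 1) * (?w - 1) = z ^ (2 ^ Suc n) - 1"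
      by (simp add: algebra_simps mult_2 power_add)
    then have "norm (?w + 1) * norm (?w - 1) = norm (z ^ (2 ^ Suc n) - 1)"
      by (metis norm_mult)
    finally show ?case using Suc.IH by simp
  qed auto
  obtain n where "1 / norm (z - 1) < (3/2) ^ n"
    using real_arch_pow[of "3/2"] by auto
  then have "1 < (3/2) ^ n * norm (z - 1)" using assms by (simp add: field_simps)
  then show False using grow[of n] small[of "2 ^ n"] by linarith
qed

text \<open>Passing to a power of the point makes the bound 1/2 independent of the group, so that
  one neighbourhood size serves all coordinates at once.\<close>

lemma (in comm_group) character_far_from_one:
  assumes "\<not> trivial_group G"
  obtains \<psi> a where "\<psi> \<in> hom G circle_group" "a \<in> carrier G" "dist (\<psi> a) 1 \<ge> 1/2"
proof -
  obtain a where a: "a \<in> carrier G" "a \<noteq> \<one>"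
    using assms is_group one_closed by (auto simp: trivial_group_def)
  obtain \<psi> where \<psi>: "\<psi> \<in> hom G circle_group" "\<psi> a \<noteq> 1"
    using nontrivial_character[OF a] .
  have "norm (\<psi> a) = 1" using hom_in_carrier[OF \<psi>(1) a(1)] by simp
  then obtain k where k: "dist (\<psi> a ^ k) 1 \<ge> 1/2"
    using circle_no_small_subgroups \<psi>(2) by blast
  interpret group_hom G circle_group \<psi>
    by (intro group_hom.intro group_hom_axioms.intro is_group \<psi>(1)
        comm_group.axioms(2) comm_group_circle_group)
  have "\<psi> (a [^] k) = \<psi> a ^ k"
    using hom_nat_pow[OF a(1)] by (simp add: nat_pow_circle_group)
  then show ?thesis using that[OF \<psi>(1), of "a [^] k"] a k by simp
qed

section \<open>Basic open sets and compact sets of the Sigma-product\<close>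

text \<open>With \<open>J\<close> ranging over the countable subsets of \<open>I\<close>, these sets
  form a neighbourhood base at \<open>x\<close>; the next two lemmas give the two
  directions.\<close>

definition sigma_cylinder ::
    "'i set \<Rightarrow> ('i \<Rightarrow> ('a, 'm) monoid_scheme) \<Rightarrow> 'i set \<Rightarrow> ('i \<Rightarrow> 'a) \<Rightarrow> ('i \<Rightarrow> 'a) set"
  where "sigma_cylinder I D J x = {y \<in> sigma_carrier I D. \<forall>j\<in>J. y j = x j}"

text \<open>Since the factors are discrete, fixing one coordinate is an open condition; fixing
  countably many is a \<open>G_\<delta>\<close> condition.\<close>

lemma openin_sigma_cylinder:
  assumes "countable J" "J \<subseteq> I" "x \<in> sigma_carrier I D"
  shows "openin (sigma_topology I D) (sigma_cylinder I D J x)"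
proof -
  let ?X = "discrete_product_topology I D"
  define U where "U j = {y \<in> topspace ?X. y j \<in> {x j}}" for j
  have "openin ?X (U j)" if "j \<in> J" for j
    unfolding U_def
  proof (rule openin_continuous_map_preimage)
    show "continuous_map ?X (discrete_topology (carrier (D j))) (\<lambda>y. y j)"
      unfolding discrete_product_topology_def
      using that assms(2) by (intro continuous_map_product_projection) auto
    show "openin (discrete_topology (carrier (D j))) {x j}"
      using that assms by (auto simp: sigma_carrier_def)
  qed
  \<comment> \<open>Inserting the whole space keeps the intersection inside it when \<open>J\<close>
    is empty.\<close>
  then have "gdelta_in ?X (\<Inter>(insert (topspace ?X) (U ` J)))"
    using assms(1) by (intro gdelta_in_Inter) (auto intro: open_imp_gdelta_in)
  then have "openin (P_modification ?X) (\<Inter>(insert (topspace ?X) (U ` J)))"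
    by (simp add: openin_P_modification arbitrary_union_of_inc)
  moreover have "sigma_cylinder I D J x = \<Inter>(insert (topspace ?X) (U ` J)) \<inter> sigma_carrier I D"
    by (auto simp: sigma_cylinder_def U_def sigma_carrier_def discrete_product_topology_def)
  ultimately show ?thesis
    unfolding sigma_topology_def openin_subtopology by blast
qed

text \<open>Each open set in a \<open>G_\<delta>\<close> representation contains a basic box around
  \<open>x\<close> that restricts finitely many coordinates; countably many such finite sets have a
  countable union.\<close>

lemma sigma_cylinder_in_open:
  assumes U: "openin (sigma_topology I D) U" and x: "x \<in> U"
  obtains J where "countable J" "J \<subseteq> I" "sigma_cylinder I D J x \<subseteq> U"
proof -
  let ?X = "discrete_product_topology I D"
  obtain V where V: "openin (P_modification ?X) V" and UV: "U = V \<inter> sigma_carrier I D"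
    using U unfolding sigma_topology_def openin_subtopology by blast
  obtain S where S: "gdelta_in ?X S" "x \<in> S" "S \<subseteq> V"
    using V x UV unfolding openin_P_modification union_of_def by fastforce
  obtain \<U> where \<U>: "countable \<U>" "\<And>W. W \<in> \<U> \<Longrightarrow> openin ?X W" "\<Inter>\<U> = S"
    using S(1) unfolding gdelta_in_alt intersection_of_def by fastforce
  have "\<exists>J. finite J \<and> J \<subseteq> I \<and> {y \<in> topspace ?X. \<forall>j\<in>J. y j = x j} \<subseteq> W" if W: "W \<in> \<U>" for W
  proof -
    have "x \<in> W" using S(2) \<U>(3) W by blast
    then obtain B where B: "finite {i \<in> I. B i \<noteq> carrier (D i)}"
      "x \<in> Pi\<^sub>E I B" "Pi\<^sub>E I B \<subseteq> W"
      using \<U>(2)[OF W] unfolding discrete_product_topology_def openin_product_topology_alt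
      by fastforce
    have "{y \<in> topspace ?X. \<forall>j\<in>{i \<in> I. B i \<noteq> carrier (D i)}. y j = x j} \<subseteq> Pi\<^sub>E I B"
    proof
      fix y assume y: "y \<in> {y \<in> topspace ?X. \<forall>j\<in>{i \<in> I. B i \<noteq> carrier (D i)}. y j = x j}"
      then have yD: "y \<in> (\<Pi>\<^sub>E i\<in>I. carrier (D i))" by (simp add: discrete_product_topology_def)
      have "y i \<in> B i" if "i \<in> I" for i
        using y yD B(2) that by (cases "B i = carrier (D i)") auto
      then show "y \<in> Pi\<^sub>E I B" using yD by (simp add: PiE_iff)
    qed
    with B show ?thesis by (intro exI[of _ "{i \<in> I. B i \<noteq> carrier (D i)}"]) auto
  qed
  then have "\<forall>W\<in>\<U>. \<exists>J. finite J \<and> J \<subseteq> I \<and> {y \<in> topspace ?X. \<forall>j\<in>J. y j = x j} \<subseteq> W" ..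
  from bchoice[OF this] obtain J where "\<forall>W\<in>\<U>. finite (J W) \<and> J W \<subseteq> I \<and>
      {y \<in> topspace ?X. \<forall>j\<in>J W. y j = x j} \<subseteq> W" ..
  note J = this[rule_format]
  show ?thesis
  proof
    show "countable (\<Union>(J ` \<U>))" using \<U>(1) J by (auto intro: countable_finite)
    show "\<Union>(J ` \<U>) \<subseteq> I" using J by blast
    show "sigma_cylinder I D (\<Union>(J ` \<U>)) x \<subseteq> U"
    proof
      fix y assume y: "y \<in> sigma_cylinder I D (\<Union>(J ` \<U>)) x"
      then have "y \<in> topspace ?X"
        by (auto simp: sigma_cylinder_def sigma_carrier_def discrete_product_topology_def)
      then have "y \<in> W" if "W \<in> \<U>" for W
        using J[OF that] y that by (auto simp: sigma_cylinder_def)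
      then show "y \<in> U" using \<U>(3) S(3) UV y by (auto simp: sigma_cylinder_def)
    qed
  qed
qed

text \<open>Countably many coordinates separate the points of a countably infinite
  \<open>C \<subseteq> K\<close>. Cylinders over these coordinates cover \<open>K\<close> but
  contain at most one point of \<open>C\<close> each, so no finite subfamily suffices.\<close>

lemma compactin_sigma_topology_imp_finite:
  assumes K: "compactin (sigma_topology I D) K"
  shows "finite K"
proof (rule ccontr)
  assume "infinite K"
  then obtain C where C: "C \<subseteq> K" "infinite C" "countable C"
    by (meson infinite_countable_subset')
  have KS: "K \<subseteq> sigma_carrier I D"
    using compactin_subset_topspace[OF K] by (simp add: topspace_sigma_topology sigma_product_def)
  have "\<exists>i\<in>I. x i \<noteq> y i" if "x \<in> C" "y \<in> C" "x \<noteq> y" for x y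
  proof -
    have "x \<in> extensional I" "y \<in> extensional I"
      using that C(1) KS by (auto simp: sigma_carrier_def PiE_iff)
    then show ?thesis using that(3) by (metis extensionalityI)
  qed
  then obtain d where d: "\<And>x y. x \<in> C \<Longrightarrow> y \<in> C \<Longrightarrow> x \<noteq> y \<Longrightarrow> d x y \<in> I \<and> x (d x y) \<noteq> y (d x y)"
    by metis
  define J where "J = (\<lambda>(x, y). d x y) ` {(x, y) \<in> C \<times> C. x \<noteq> y}"
  have "countable {(x, y) \<in> C \<times> C. x \<noteq> y}"
    by (rule countable_subset[of _ "C \<times> C"]) (use C(3) in auto)
  then have J: "countable J" "J \<subseteq> I" using d by (auto simp: J_def)
  have "\<exists>\<F>. finite \<F> \<and> \<F> \<subseteq> sigma_cylinder I D J ` K \<and> K \<subseteq> \<Union>\<F>"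
  proof -
    have "\<forall>U\<in>sigma_cylinder I D J ` K. openin (sigma_topology I D) U"
      using openin_sigma_cylinder[OF J] KS by blast
    moreover have "K \<subseteq> \<Union>(sigma_cylinder I D J ` K)"
      using KS by (auto simp: sigma_cylinder_def)
    ultimately show ?thesis using K unfolding compactin_def by meson
  qed
  then obtain \<F> where \<F>: "finite \<F>" "\<F> \<subseteq> sigma_cylinder I D J ` K" "K \<subseteq> \<Union>\<F>" by blast
  have "x = y" if W: "W \<in> \<F>" "x \<in> W" "y \<in> W" "x \<in> C" "y \<in> C" for x y W
  proof (rule ccontr)
    assume "x \<noteq> y"
    then have "d x y \<in> J" using W by (auto simp: J_def)
    moreover obtain k where "W = sigma_cylinder I D J k" using \<F>(2) W(1) by blast
    ultimately have "x (d x y) = y (d x y)" using W by (simp add: sigma_cylinder_def)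
    then show False using d[OF W(4,5) \<open>x \<noteq> y\<close>] by simp
  qed
  moreover have "\<exists>W\<in>\<F>. x \<in> W" if "x \<in> C" for x using that C(1) \<F>(3) by blast
  \<comment> \<open>Choosing for each point of \<open>C\<close> a member of the subcover containing
    it is injective, which contradicts finiteness of \<open>\<F>\<close>.\<close>
  ultimately have "\<exists>f. inj_on f C \<and> f ` C \<subseteq> \<F>"
    by (metis (no_types, lifting) image_subsetI inj_onI)
  then show False using C(2) \<F>(1) finite_subset inj_on_finite by blast
qed

section \<open>Compact sets and neighbourhoods in the dual topology\<close>

text \<open>With finite compact sets, a basic neighbourhood in the dual constrains finitely many
  values. The identity on \<open>K\<close> is therefore continuous from the pointwise topology to
  the dual topology and carries compactness over.\<close>

lemma compactin_dual_topology_if_pointwise: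
  assumes fin: "\<And>C. compactin T C \<Longrightarrow> finite C"
    and top: "topspace T = carrier G"
    and K: "compactin (product_topology (\<lambda>_. circle_topology) (carrier G)) K"
    and chars: "K \<subseteq> characters G T"
  shows "compactin (dual_topology G T) K"
proof -
  let ?Z = "product_topology (\<lambda>_. circle_topology) (carrier G)"
  have "continuous_map (subtopology ?Z K) (dual_topology G T) id"
    unfolding continuous_map_def
  proof (intro conjI allI impI)
    show "id \<in> topspace (subtopology ?Z K) \<rightarrow> topspace (dual_topology G T)"
      using chars by (auto simp: topspace_dual_topology dual_group_def)
    fix U assume U: "openin (dual_topology G T) U"
    show "openin (subtopology ?Z K) {x \<in> topspace (subtopology ?Z K). id x \<in> U}"
    proof (subst openin_subopen, safe)
      fix \<phi> assume "\<phi> \<in> topspace (subtopology ?Z K)" "id \<phi> \<in> U"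
      then have \<phi>: "\<phi> \<in> topspace ?Z" "\<phi> \<in> K" "\<phi> \<in> U" by auto
      obtain C e where C: "compactin T C" "e > 0" "uniform_nbhd G T C e \<phi> \<subseteq> U"
        using U \<phi>(3) unfolding openin_dual_topology by blast
      have finC: "finite C" using fin C(1) .
      have CG: "C \<subseteq> carrier G" using compactin_subset_topspace[OF C(1)] top by simp
      define V where "V x = {\<psi> \<in> topspace ?Z. \<psi> x \<in> ball (\<phi> x) e \<inter> sphere 0 1}" for x
      have "openin ?Z (V x)" if "x \<in> C" for x
        unfolding V_def
      proof (rule openin_continuous_map_preimage)
        show "continuous_map ?Z circle_topology (\<lambda>\<psi>. \<psi> x)"
          using that CG by (intro continuous_map_product_projection) auto
        show "openin circle_topology (ball (\<phi> x) e \<inter> sphere 0 1)"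
          unfolding circle_topology_def by (auto simp: openin_subtopology)
      qed
      then have "openin ?Z (\<Inter>(insert (topspace ?Z) (V ` C)))"
        using finC by (intro openin_Inter) (auto simp del: topspace_product_topology)
      then have "openin (subtopology ?Z K) (\<Inter>(insert (topspace ?Z) (V ` C)) \<inter> K)"
        unfolding openin_subtopology by blast
      moreover have "\<phi> \<in> \<Inter>(insert (topspace ?Z) (V ` C)) \<inter> K"
        using \<phi> C(2) CG by (auto simp: V_def circle_topology_def PiE_iff)
      moreover have "\<Inter>(insert (topspace ?Z) (V ` C)) \<inter> K \<subseteq> {x \<in> topspace (subtopology ?Z K). id x \<in> U}"
        using C(3) chars by (auto simp: V_def uniform_nbhd_def dist_commute)
      ultimately show "\<exists>S. openin (subtopology ?Z K) S \<and> \<phi> \<in> S \<and>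
          S \<subseteq> {x \<in> topspace (subtopology ?Z K). id x \<in> U}" by blast
    qed
  qed
  moreover have "compactin (subtopology ?Z K) K" using K by (simp add: compactin_subtopology)
  ultimately show ?thesis using image_compactin[of "subtopology ?Z K" K "dual_topology G T" id] by simp
qed

lemma uniform_nbhd_contains_open:
  assumes "compactin T K" "e > 0" "\<phi> \<in> characters G T"
  obtains V where "openin (dual_topology G T) V" "\<phi> \<in> V" "V \<subseteq> uniform_nbhd G T K e \<phi>"
proof
  \<comment> \<open>A single bound \<open>d < e\<close> on all of \<open>K\<close> leaves the slack
    \<open>e - d\<close>; half of it is spent in the triangle inequality and the bound
    \<open>(e + d) / 2\<close> is still below \<open>e\<close>.\<close>
  let ?V = "{\<psi> \<in> characters G T. \<exists>d<e. \<forall>x\<in>K. dist (\<psi> x) (\<phi> x) \<le> d}"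
  show "\<phi> \<in> ?V" using assms by auto
  show "?V \<subseteq> uniform_nbhd G T K e \<phi>" by (force simp: uniform_nbhd_def)
  show "openin (dual_topology G T) ?V"
    unfolding openin_dual_topology
  proof (intro conjI ballI)
    fix \<psi> assume "\<psi> \<in> ?V"
    then obtain d where d: "d < e" "\<And>x. x \<in> K \<Longrightarrow> dist (\<psi> x) (\<phi> x) \<le> d" by blast
    have "uniform_nbhd G T K ((e - d) / 2) \<psi> \<subseteq> ?V"
    proof
      fix \<theta> assume \<theta>: "\<theta> \<in> uniform_nbhd G T K ((e - d) / 2) \<psi>"
      have "dist (\<theta> x) (\<phi> x) \<le> (e + d) / 2" if "x \<in> K" for x
      proof -
        have "dist (\<theta> x) (\<psi> x) < (e - d) / 2" using \<theta> that by (simp add: uniform_nbhd_def)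
        then show ?thesis
          using d(2)[OF that] dist_triangle[of "\<theta> x" "\<phi> x" "\<psi> x"] by (simp add: field_simps)
      qed
      moreover have "(e + d) / 2 < e" using d(1) by simp
      ultimately show "\<theta> \<in> ?V" using \<theta> unfolding uniform_nbhd_def by blast
    qed
    then show "\<exists>K' e'. compactin T K' \<and> e' > 0 \<and> uniform_nbhd G T K' e' \<psi> \<subseteq> ?V"
      using assms(1) d(1) by (intro exI[of _ K] exI[of _ "(e - d) / 2"]) auto
  qed auto
qed

section \<open>Failure of continuity of the evaluation map on the Sigma-product\<close>

lemma sigma_product_simps [simp]:
  "carrier (sigma_product I D) = sigma_carrier I D"
  "x \<otimes>\<^bsub>sigma_product I D\<^esub> y = (\<lambda>i\<in>I. x i \<otimes>\<^bsub>D i\<^esub> y i)"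
  by (simp_all add: sigma_product_def)

theorem theorem1:
  fixes I :: "'i set" and D :: "'i \<Rightarrow> ('a, 'm) monoid_scheme"
  assumes "uncountable I"
    and "\<And>i. i \<in> I \<Longrightarrow> comm_group (D i)"
    and "\<And>i. i \<in> I \<Longrightarrow> \<not> trivial_group (D i)"
  shows "\<not> reflexive_group (sigma_product I D) (sigma_topology I D)"
proof
  let ?G = "sigma_product I D" and ?T = "sigma_topology I D" and ?S = "sigma_carrier I D"
  assume refl: "reflexive_group ?G ?T"
  have grp: "group (D i)" if "i \<in> I" for i using assms(2)[OF that] by (simp add: comm_group.axioms)
  have subgrp: "subgroup ?S (product_group I D)" by (rule subgroup_sigma_carrier) (rule grp)
  have top: "topspace ?T = ?S" by (simp add: topspace_sigma_topology)
  have "\<exists>c a. c \<in> hom (D i) circle_group \<and> a \<in> carrier (D i) \<and> dist (c a) 1 \<ge> 1/2" if "i \<in> I" for i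
    using comm_group.character_far_from_one[OF assms(2,3)[OF that]] by blast
  then obtain c a where c: "\<And>i. i \<in> I \<Longrightarrow> c i \<in> hom (D i) circle_group"
    and a: "\<And>i. i \<in> I \<Longrightarrow> a i \<in> carrier (D i)" "\<And>i. i \<in> I \<Longrightarrow> dist (c i (a i)) 1 \<ge> 1/2"
    by metis
  have c1: "c i \<one>\<^bsub>D i\<^esub> = 1" if "i \<in> I" for i
    using hom_one[OF c[OF that] grp[OF that]] comm_group.axioms(2)[OF comm_group_circle_group] by simp
  define p where "p i = (\<lambda>x\<in>?S. c i (x i))" for i
  let ?Z = "product_topology (\<lambda>_. circle_topology) ?S"
  \<comment> \<open>The closure is taken in the full power of the circle, where compactness comes
    from Tychonoff; that its points are continuous characters is proved in
    \<open>charK\<close>.\<close>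
  define K where "K = ?Z closure_of (p ` I)"
  have SD: "x i \<in> carrier (D i)" if "x \<in> ?S" "i \<in> I" for x i
    using that by (auto simp: sigma_carrier_def)
  have pZ: "p i \<in> topspace ?Z" if "i \<in> I" for i
    using hom_in_carrier[OF c[OF that] SD[OF _ that]]
    by (auto simp: p_def circle_topology_def)
  have proj: "continuous_map ?Z circle_topology (\<lambda>\<phi>. \<phi> x)" if "x \<in> ?S" for x
    using that by (intro continuous_map_product_projection)
  have projc: "continuous_map ?Z euclidean (\<lambda>\<phi>. \<phi> x)" if "x \<in> ?S" for x
    using proj[OF that] by (simp add: circle_topology_def continuous_map_in_subtopology)
  have haus: "Hausdorff_space circle_topology"
    unfolding circle_topology_def by (intro Hausdorff_space_subtopology Hausdorff_space_euclidean)
  have compactK: "compactin ?Z K"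
    unfolding K_def
  proof (rule closedin_compact_space)
    have "compact_space circle_topology"
      unfolding circle_topology_def by (simp add: compact_space_subtopology)
    then show "compact_space ?Z" by (simp add: compact_space_product_topology)
  qed simp
  have charK: "\<phi> \<in> characters ?G ?T" if \<phi>: "\<phi> \<in> K" for \<phi>
  proof -
    have \<phi>Z: "\<phi> \<in> ?S \<rightarrow>\<^sub>E sphere 0 1"
      using \<phi> closure_of_subset_topspace[of ?Z "p ` I"] by (auto simp: K_def circle_topology_def)
    have mult: "\<phi> (x \<otimes>\<^bsub>?G\<^esub> y) = \<phi> x * \<phi> y" if x: "x \<in> ?S" and y: "y \<in> ?S" for x y
    proof -
      have xy: "x \<otimes>\<^bsub>?G\<^esub> y \<in> ?S" using subgroup.m_closed[OF subgrp x y] by simp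
      show ?thesis
      \<comment> \<open>Both sides are continuous in the character for fixed \<open>x\<close> and
        \<open>y\<close>, so the identity passes from the \<open>p i\<close> to their
        closure.\<close>
      proof (rule forall_in_closure_of_eq[OF \<phi>[unfolded K_def] Hausdorff_space_euclidean projc[OF xy]])
        show "continuous_map ?Z euclidean (\<lambda>\<phi>. \<phi> x * \<phi> y)"
          using projc[OF x] projc[OF y] by (simp add: continuous_map_atin tendsto_mult)
        fix \<psi> assume "\<psi> \<in> p ` I"
        then obtain i where "i \<in> I" "\<psi> = p i" by blast
        then show "\<psi> (x \<otimes>\<^bsub>?G\<^esub> y) = \<psi> x * \<psi> y"
          using x y xy hom_mult[OF c SD SD] by (simp add: p_def)
      qed
    qed
    have "\<exists>J. countable J \<and> J \<subseteq> I \<and> (\<forall>x\<in>?S. \<forall>y\<in>?S. (\<forall>j\<in>J. x j = y j) \<longrightarrow> \<phi> x = \<phi> y)"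
    \<comment> \<open>If countably many \<open>p j\<close> suffice to approximate
      \<open>\<phi>\<close>, then \<open>\<phi>\<close> inherits their dependence on the coordinates
      in \<open>J\<close> alone.\<close>
    proof (cases "\<exists>J. countable J \<and> J \<subseteq> I \<and> \<phi> \<in> ?Z closure_of (p ` J)")
      case True
      then obtain J where J: "countable J" "J \<subseteq> I" "\<phi> \<in> ?Z closure_of (p ` J)" by blast
      have "\<phi> x = \<phi> y" if x: "x \<in> ?S" and y: "y \<in> ?S" and eq: "\<forall>j\<in>J. x j = y j" for x y
        by (rule forall_in_closure_of_eq[OF J(3) haus proj[OF x] proj[OF y]])
          (use x y eq in \<open>auto simp: p_def\<close>)
      with J show ?thesis by blast
    next
      case False
      have "\<phi> x = 1" if x: "x \<in> ?S" for x
      proof -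
        have J: "countable (supp I D x)" "supp I D x \<subseteq> I"
          using x by (auto simp: sigma_carrier_def supp_def)
        have "p ` I = p ` supp I D x \<union> p ` (I - supp I D x)" using J(2) by blast
        \<comment> \<open>The closure of the finite union splits, and the part over the countable
          support is excluded by the case assumption. On the remaining part every \<open>p i\<close>
          takes the value 1 at \<open>x\<close>.\<close>
        then have "\<phi> \<in> ?Z closure_of (p ` (I - supp I D x))"
          using \<phi> False J unfolding K_def by (metis Un_iff closure_of_Un)
        moreover have "continuous_map ?Z euclidean (\<lambda>_. 1::complex)" by simp
        ultimately show ?thesis
          by (rule forall_in_closure_of_eq[OF _ Hausdorff_space_euclidean projc[OF x]])
            (use x c1 in \<open>auto simp: p_def supp_def\<close>)
      qed
      then show ?thesis by (intro exI[of _ "{}"]) auto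
    qed
    then obtain J where J: "countable J" "J \<subseteq> I"
      "\<And>x y. x \<in> ?S \<Longrightarrow> y \<in> ?S \<Longrightarrow> \<forall>j\<in>J. x j = y j \<Longrightarrow> \<phi> x = \<phi> y" by blast
    have "continuous_map ?T circle_topology \<phi>"
      unfolding continuous_map_def
    proof (intro conjI allI impI)
      show "\<phi> \<in> topspace ?T \<rightarrow> topspace circle_topology"
        using \<phi>Z by (auto simp: top circle_topology_def)
      \<comment> \<open>\<open>U\<close> may be any set: \<open>\<phi>\<close> is constant on
        cylinders over \<open>J\<close>, hence locally constant.\<close>
      fix U
      show "openin ?T {x \<in> topspace ?T. \<phi> x \<in> U}"
      proof (subst openin_subopen, safe)
        fix x assume x: "x \<in> topspace ?T" "\<phi> x \<in> U"
        then have "openin ?T (sigma_cylinder I D J x)"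
          by (intro openin_sigma_cylinder J) (simp add: top)
        moreover have "x \<in> sigma_cylinder I D J x" using x by (simp add: sigma_cylinder_def top)
        moreover have "sigma_cylinder I D J x \<subseteq> {x \<in> topspace ?T. \<phi> x \<in> U}"
        proof
          fix y assume y: "y \<in> sigma_cylinder I D J x"
          then have "\<phi> y = \<phi> x" using x(1) by (intro J(3)) (simp_all add: sigma_cylinder_def top)
          then show "y \<in> {x \<in> topspace ?T. \<phi> x \<in> U}" using x(2) y by (simp add: sigma_cylinder_def top)
        qed
        ultimately show "\<exists>V. openin ?T V \<and> x \<in> V \<and> V \<subseteq> {x \<in> topspace ?T. \<phi> x \<in> U}" by blast
      qed
    qed
    moreover have "\<phi> \<in> hom ?G circle_group"
      by (rule homI) (use \<phi>Z mult in auto)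
    ultimately show ?thesis using \<phi>Z by (auto simp: characters_def PiE_iff)
  qed
  let ?G' = "dual_group ?G ?T" and ?T' = "dual_topology ?G ?T"
  have K': "compactin ?T' K"
    by (rule compactin_dual_topology_if_pointwise[OF compactin_sigma_topology_imp_finite])
      (use top compactK charK in auto)
  let ?\<alpha> = "evaluation ?G ?T"
  \<comment> \<open>This consequence of reflexivity will be contradicted at the neutral element, on
    the compact set \<open>K\<close>.\<close>
  have cont: "continuous_map ?T (dual_topology ?G' ?T') ?\<alpha>"
    using refl by (simp add: reflexive_group_def homeomorphic_imp_continuous_map)
  let ?e = "\<one>\<^bsub>product_group I D\<^esub>"
  have e: "?e \<in> ?S" using subgroup.one_closed[OF subgrp] .
  have "?\<alpha> ?e \<in> topspace (dual_topology ?G' ?T')"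
    using cont e unfolding continuous_map_def top by blast
  then have "?\<alpha> ?e \<in> characters ?G' ?T'" by (simp add: topspace_dual_topology dual_group_def)
  then obtain V where V: "openin (dual_topology ?G' ?T') V" "?\<alpha> ?e \<in> V"
    "V \<subseteq> uniform_nbhd ?G' ?T' K (1/2) (?\<alpha> ?e)"
    using uniform_nbhd_contains_open[OF K', of "1/2"] by (metis half_gt_zero zero_less_one)
  have "openin ?T {x \<in> topspace ?T. ?\<alpha> x \<in> V}"
    using cont V(1) by (rule openin_continuous_map_preimage)
  moreover have "?e \<in> {x \<in> topspace ?T. ?\<alpha> x \<in> V}" using e V(2) top by simp
  ultimately obtain J where J: "countable J" "J \<subseteq> I"
    "sigma_cylinder I D J ?e \<subseteq> {x \<in> topspace ?T. ?\<alpha> x \<in> V}"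
    by (rule sigma_cylinder_in_open)
  \<comment> \<open>Uncountability of \<open>I\<close> leaves a coordinate \<open>i\<close> that the
    cylinder does not restrict.\<close>
  have "\<not> I \<subseteq> J" using assms(1) J(1) countable_subset by blast
  then obtain i where i: "i \<in> I" "i \<notin> J" by blast
  \<comment> \<open>This point agrees with the neutral element on \<open>J\<close>, yet
    \<open>p i\<close> sends it to \<open>c i (a i)\<close>, at distance at least 1/2 from
    1.\<close>
  define x where "x = (\<lambda>j\<in>I. if j = i then a i else \<one>\<^bsub>D j\<^esub>)"
  have "supp I D x \<subseteq> {i}" by (auto simp: supp_def x_def)
  then have "countable (supp I D x)" by (meson countable_finite finite.emptyI finite.insertI finite_subset)
  then have x: "x \<in> ?S"
    using i a grp by (auto simp: sigma_carrier_def x_def group.is_monoid)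
  have "x \<in> sigma_cylinder I D J ?e"
    using x J(2) i by (auto simp: sigma_cylinder_def x_def)
  then have "?\<alpha> x \<in> uniform_nbhd ?G' ?T' K (1/2) (?\<alpha> ?e)" using J(3) V(3) by blast
  moreover have pK: "p i \<in> K"
    unfolding K_def using closure_of_subset[of "p ` I" ?Z] pZ i by blast
  ultimately have "dist (?\<alpha> x (p i)) (?\<alpha> ?e (p i)) < 1/2" by (simp add: uniform_nbhd_def)
  moreover have "?\<alpha> x (p i) = c i (a i)" "?\<alpha> ?e (p i) = 1"
    using charK[OF pK] x e i c1 by (auto simp: evaluation_def p_def x_def)
  ultimately show False using a(2)[OF i(1)] by simp
qed

end
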